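(* Let $n$ and $m$ be positive integers. For integers $N$ and $M\geq 0$, let $p_d(N,[n+1,n+m-1],M)$ be the number of partitions of $N$ into exactly $M$ distinct parts, all lying in the integer interval $\{n+1,n+2,\ldots,n+m-1\}$. For integers $j$ and $l\geq 0$, let \[ a_{j,l}=p_d(j,[n+1,n+m-1],4l),\quad c_{j,l}=p_d(j,[n+1,n+m-1],4l-1), \] \[ b_{j,l}=p_d(j,[n+1,n+m-1],4l+2),\quad d_{j,l}=p_d(j,[n+1,n+m-1],4l+1). \] Then \begin{align*} \sum_{k=-\infty}^{\infty} (-1)^k q^{2k^2-k}{2n+m\brack n+2k} = (-q^2;q^2)_n\Bigg\{&\sum_{l=0}^{\lfloor\frac{m-1}{4}\rfloor}\ \sum_{j=2l(2n+4l+1)}^{2l(2n+2m-4l-1)} a_{j,l}q^j+\sum_{l=0}^{\lfloor\frac{m}{4}\rfloor}\ \sum_{j=(4l-1)(n+2l)}^{(4l-1)(n+m-2l)} c_{j,l}q^j\\ &-\Bigg(\sum_{l=0}^{\lfloor\frac{m-3}{4}\rfloor}\ \sum_{j=(2l+1)(2n+4l+3)}^{(2l+1)(2n+2m-4l-3)} b_{j,l}q^j+\sum_{l=0}^{\lfloor\frac{m-2}{4}\rfloor}\ \sum_{j=(4l+1)(n+2l+1)}^{(4l+1)(n+m-2l-1)} d_{j,l}q^j\Bigg)\Bigg\}. \end{align*}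
   Context: $(a;q)_0=1$ and $(a;q)_n=\prod_{i=0}^{n-1}(1-aq^i)$. The $q$-binomial coefficient is ${N\brack M}=\frac{(q;q)_N}{(q;q)_M(q;q)_{N-M}}$ if $N\ge M\ge 0$, and $0$ otherwise. The empty partition counts as the unique partition of $0$ into $0$ parts, and $p_d(N,[n+1,n+m-1],M)=0$ whenever $N<0$. A sum whose upper limit is smaller than its lower limit is empty, equal to $0$; in particular the $l=0$ term of the $c$-sum, whose index range runs from $-n$ down to $-(n+m)$, is $0$. *)

theory Defs
  imports Main "HOL-Library.Multiset" "HOL-Library.Groups_Big_Fun"
begin

definition qpoch :: "'a::field \<Rightarrow> 'a \<Rightarrow> nat \<Rightarrow> 'a" where
  "qpoch a q n = (\<Prod>i<n. 1 - a * q ^ i)"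

text \<open>The division below is the intended one only if \<^term>\<open>q\<close> is not a root of unity
  (otherwise a denominator may vanish).\<close>

definition qbinom :: "'a::field \<Rightarrow> int \<Rightarrow> int \<Rightarrow> 'a" where
  "qbinom q N M =
     (if 0 \<le> M \<and> M \<le> N
      then qpoch q q (nat N) / (qpoch q q (nat M) * qpoch q q (nat (N - M)))
      else 0)"

text \<open>A partition is the multiset of its (positive) parts.  The number of parts is an
  integer argument so that \<open>4 * l - 1\<close> is not truncated at \<open>l = 0\<close>.\<close>

definition distinct_partitions :: "int \<Rightarrow> nat set \<Rightarrow> int \<Rightarrow> nat multiset set" where
  "distinct_partitions N I M =
     {P. 0 \<notin># P \<and> int (sum_mset P) = N \<and> int (size P) = M
         \<and> (\<forall>i. count P i \<le> 1) \<and> set_mset P \<subseteq> I}"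

definition p_d :: "int \<Rightarrow> nat set \<Rightarrow> int \<Rightarrow> nat" where
  "p_d N I M = card (distinct_partitions N I M)"

lemma finite_distinct_partitions:
  assumes "finite I"
  shows "finite (distinct_partitions N I M)"
proof (rule finite_subset)
  show "distinct_partitions N I M \<subseteq> mset_set ` Pow I"
  proof
    fix P assume P: "P \<in> distinct_partitions N I M"
    have "count P i = count (mset_set (set_mset P)) i" for i
    proof (cases "i \<in># P")
      case True
      then have "count P i \<ge> 1" by (simp add: Suc_leI)
      moreover have "count P i \<le> 1" using P by (simp add: distinct_partitions_def)
      ultimately have "count P i = 1" by (rule antisym[rotated])
      then show ?thesis using True by simp
    next
      case False
      then show ?thesis by (simp add: not_in_iff)
    qed
    then have "P = mset_set (set_mset P)" by (rule multiset_eqI)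
    then show "P \<in> mset_set ` Pow I" using P by (auto simp: distinct_partitions_def)
  qed
  show "finite (mset_set ` Pow I)" using assms by simp
qed

definition a_coeff :: "nat \<Rightarrow> nat \<Rightarrow> int \<Rightarrow> int \<Rightarrow> nat" where
  "a_coeff n m j l = p_d j {n+1..n+m-1} (4 * l)"

definition b_coeff :: "nat \<Rightarrow> nat \<Rightarrow> int \<Rightarrow> int \<Rightarrow> nat" where
  "b_coeff n m j l = p_d j {n+1..n+m-1} (4 * l + 2)"

definition c_coeff :: "nat \<Rightarrow> nat \<Rightarrow> int \<Rightarrow> int \<Rightarrow> nat" where
  "c_coeff n m j l = p_d j {n+1..n+m-1} (4 * l - 1)"

definition d_coeff :: "nat \<Rightarrow> nat \<Rightarrow> int \<Rightarrow> int \<Rightarrow> nat" where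
  "d_coeff n m j l = p_d j {n+1..n+m-1} (4 * l + 1)"

text \<open>The sum over all integers \<open>k\<close> is rendered by \<^const>\<open>Sum_any\<close>, which sums a function of
  finite support over a whole type; the following lemma supplies the finite support.\<close>

lemma finite_support_qbinom_sum:
  fixes q :: "'a::field"
  shows "finite {k::int. (- 1) powi k * q powi (2 * k ^ 2 - k)
                   * qbinom q (int (2 * n + m)) (int n + 2 * k) \<noteq> 0}"
proof (rule finite_subset)
  show "{k::int. (- 1) powi k * q powi (2 * k ^ 2 - k)
           * qbinom q (int (2 * n + m)) (int n + 2 * k) \<noteq> 0} \<subseteq> {- int n..int (2 * n + m)}"
    by (auto simp: qbinom_def split: if_splits)
qed simp

end

theory Submission
  imports Defs
begin

text \<open>Formally, the \<open>q\<close>-binomial theorem says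
  \<open>\<Sum>s. z ^ s * q ^ (s choose 2) * [n + k, n + s] = (\<Prod>j<k. 1 + z q ^ j) * (\<Prod>j=1..n. 1 + q ^ j / z)\<close>.
  Put \<open>k = n + m\<close> and \<open>z = \<i>\<close>.  The factors \<open>(1 + \<i> q ^ j) (1 - \<i> q ^ j)\<close> with \<open>1 \<le> j \<le> n\<close> give
  \<open>(- q\<^sup>2; q\<^sup>2)\<^sub>n\<close>, leaving \<open>(1 + \<i>) * (\<Prod>j=n+1..n+m-1. 1 + \<i> q ^ j)\<close>, whose
  expansion runs over the partitions into distinct parts.  The real part is the claim.
  Since the field need not contain a square root of \<open>-1\<close>, the powers \<open>z ^ s\<close> are replaced by
  \<open>\<epsilon> s\<close> for an arbitrary sequence \<open>\<epsilon>\<close>, so that multiplication by \<open>z\<close> is a shift, and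
  \<open>\<i>\<close> is encoded as \<open>\<epsilon> (s + 2) = - \<epsilon> s\<close>.\<close>

section \<open>The \<open>q\<close>-binomial theorem\<close>

lemma qpoch_Suc: "qpoch a q (Suc n) = qpoch a q n * (1 - a * q ^ n)"
  by (simp add: qpoch_def)

lemma qpoch_nonzero:
  fixes q :: "'a::field"
  assumes "\<And>i::nat. i > 0 \<Longrightarrow> q ^ i \<noteq> 1"
  shows "qpoch q q n \<noteq> 0"
proof -
  have "1 - q * q ^ i \<noteq> 0" for i
    using assms[of "Suc i"] by (metis eq_iff_diff_eq_0 power_Suc zero_less_Suc)
  then show ?thesis by (simp add: qpoch_def)
qed

lemma qbinom_eq_0: "M < 0 \<or> M > N \<Longrightarrow> qbinom q N M = 0"
  by (auto simp: qbinom_def)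

lemma qbinom_0_right:
  fixes q :: "'a::field"
  assumes "\<And>i::nat. i > 0 \<Longrightarrow> q ^ i \<noteq> 1" and "N \<ge> 0"
  shows "qbinom q N 0 = 1"
  using assms(2) qpoch_nonzero[OF assms(1)] by (simp add: qbinom_def) (simp add: qpoch_def)

lemma qbinom_symmetric: "qbinom q N (N - M) = qbinom q N M"
  by (simp add: qbinom_def mult.commute)

text \<open>For 0 < r <= N this is 1 - q^(N+1) = (1 - q^r) + q^r (1 - q^(N+1-r)) over a common
  denominator. At r = 0 and r = N + 1 one term on the right vanishes; beyond, all three coefficients
  do, so the truncation in \<open>nat r\<close> is harmless.\<close>

lemma qbinom_pascal:
  fixes q :: "'a::field"
  assumes q: "\<And>i::nat. i > 0 \<Longrightarrow> q ^ i \<noteq> 1" and N: "N \<ge> 0"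
  shows "qbinom q (N + 1) r = qbinom q N (r - 1) + q ^ nat r * qbinom q N r"
proof -
  consider "r < 0 \<or> r > N + 1" | "r = 0" | "r = N + 1" "r \<noteq> 0" | "0 < r" "r \<le> N" by linarith
  then show ?thesis
  proof cases
    case 1
    then show ?thesis by (auto simp: qbinom_eq_0)
  next
    case 2
    then show ?thesis using N by (simp add: qbinom_0_right[OF q] qbinom_eq_0)
  next
    case 3
    then show ?thesis
      using N qbinom_symmetric[of q N 0] qbinom_symmetric[of q "N + 1" 0]
      by (simp add: qbinom_0_right[OF q] qbinom_eq_0)
  next
    case 4
    define a b where "a = nat (r - 1)" and "b = nat (N - r)"
    have eqs: "r = int (Suc a)" "N = int (a + b + 1)" using 4 by (auto simp: a_def b_def)
    define P where "P = qpoch q q"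
    have nz: "P k \<noteq> 0" for k by (simp add: P_def qpoch_nonzero[OF q])
    have S: "P (Suc k) = P k * (1 - q ^ Suc k)" for k by (simp add: P_def qpoch_Suc)
    have nz': "1 - q ^ Suc k \<noteq> 0" for k using S[of k] nz[of "Suc k"] by auto
    have *: "qbinom q (N + 1) r = P (Suc (Suc (a + b))) / (P (Suc a) * P (Suc b))"
      "qbinom q N (r - 1) = P (Suc (a + b)) / (P a * P (Suc b))"
      "qbinom q N r = P (Suc (a + b)) / (P (Suc a) * P b)"
    proof -
      have "nat (N + 1) = Suc (Suc (a + b))" "nat r = Suc a" "nat (N + 1 - r) = Suc b"
        "nat N = Suc (a + b)" "nat (r - 1) = a" "nat (N - (r - 1)) = Suc b" "nat (N - r) = b"
        using eqs by simp_all
      then show "qbinom q (N + 1) r = P (Suc (Suc (a + b))) / (P (Suc a) * P (Suc b))"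
        "qbinom q N (r - 1) = P (Suc (a + b)) / (P a * P (Suc b))"
        "qbinom q N r = P (Suc (a + b)) / (P (Suc a) * P b)"
        using 4 by (simp_all only: qbinom_def P_def) simp_all
    qed
    have "1 - q ^ Suc (Suc (a + b)) = (1 - q ^ Suc a) + q ^ Suc a * (1 - q ^ Suc b)"
      by (simp add: algebra_simps power_add)
    then have num: "P (Suc (Suc (a + b))) =
        P (Suc (a + b)) * ((1 - q ^ Suc a) + q ^ Suc a * (1 - q ^ Suc b))"
      by (simp only: S)
    have frac: "x * (u + v * w) / ((Q * u) * (R * w)) =
        x / (Q * (R * w)) + v * (x / ((Q * u) * R))"
      if "u \<noteq> 0" "w \<noteq> 0" "Q \<noteq> 0" "R \<noteq> 0" for x u v w Q R :: 'a
      using that by (simp add: field_simps)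
    have "nat r = Suc a" using eqs by simp
    then show ?thesis
      unfolding * num S[of a] S[of b] by (simp only: frac nz nz' not_False_eq_True)
  qed
qed

text \<open>Replacing r by N + 1 - r and using symmetry moves the power of q to the other
  term.\<close>

lemma qbinom_pascal':
  fixes q :: "'a::field"
  assumes q: "\<And>i::nat. i > 0 \<Longrightarrow> q ^ i \<noteq> 1" and N: "N \<ge> 0"
  shows "qbinom q (N + 1) r = qbinom q N r + q ^ nat (N + 1 - r) * qbinom q N (r - 1)"
  using qbinom_pascal[OF q N, of "N + 1 - r"] qbinom_symmetric[of q "N + 1" r]
    qbinom_symmetric[of q N r] qbinom_symmetric[of q N "r - 1"]
  by (simp add: algebra_simps)

definition triangle :: "int \<Rightarrow> nat" where
  "triangle s = nat (s * (s - 1) div 2)"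

text \<open>Consecutive integers never have opposite signs, so \<open>nat\<close> truncates nothing
  in \<open>triangle\<close>. Negative s thus give natural exponents too, which keeps inverses of q
  out of the sums.\<close>

lemma int_triangle: "2 * int (triangle s) = s * (s - 1)"
proof -
  have "s * (s - 1) \<ge> 0"
    by (cases "s \<le> 0") (auto intro: mult_nonpos_nonpos)
  then show ?thesis by (simp add: triangle_def)
qed

lemma triangle_Suc: "int (triangle (s + 1)) = int (triangle s) + s"
  using int_triangle[of s] int_triangle[of "s + 1"] by (simp add: algebra_simps)

text \<open>The expanded side of the q-binomial theorem as a linear functional of \<epsilon>:
  \<open>k\<close> counts the factors 1 + z q^j, \<open>n\<close> the factors 1 + q^j / z.\<close>

definition theta_sum :: "'a::field \<Rightarrow> nat \<Rightarrow> nat \<Rightarrow> (int \<Rightarrow> 'a) \<Rightarrow> 'a" where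
  "theta_sum q k n \<epsilon> =
     (\<Sum>s = - int n..int k. \<epsilon> s * (q ^ triangle s * qbinom q (int (n + k)) (int n + s)))"

text \<open>Lets the shifted and unshifted sums in the recurrences below share one range.\<close>

lemma theta_sum_superset:
  assumes "finite A" "{- int n..int k} \<subseteq> A"
  shows "theta_sum q k n \<epsilon> =
     (\<Sum>s\<in>A. \<epsilon> s * (q ^ triangle s * qbinom q (int (n + k)) (int n + s)))"
  unfolding theta_sum_def using assms
  by (intro sum.mono_neutral_left) (auto simp: qbinom_def)

lemma theta_sum_uminus: "theta_sum q k n (\<lambda>s. - \<epsilon> s) = - theta_sum q k n \<epsilon>"
  by (simp add: theta_sum_def sum_negf)

text \<open>Adjoins the factor 1 + q^(n+1) / z, division by z being the shift to s - 1. After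
  Pascal's recurrence, triangle s + (n + 1 + s) = (n + 1) + triangle (s + 1) pulls q^(n+1) out of
  the second half.\<close>

lemma theta_sum_Suc_lower:
  fixes q :: "'a::field"
  assumes q: "\<And>i::nat. i > 0 \<Longrightarrow> q ^ i \<noteq> 1"
  shows "theta_sum q k (Suc n) \<epsilon> =
    theta_sum q k n \<epsilon> + q ^ Suc n * theta_sum q k n (\<lambda>s. \<epsilon> (s - 1))"
proof -
  let ?A = "{- int n - 1..int k}"
  let ?B = "\<lambda>s. qbinom q (int (n + k)) (int n + s)"
  have summand: "q ^ triangle s * qbinom q (int (Suc n + k)) (int (Suc n) + s) =
      q ^ triangle s * ?B s + q ^ Suc n * (q ^ triangle (s + 1) * ?B (s + 1))"
    if "s \<in> ?A" for s
  proof -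
    \<comment> \<open>On \<open>?A\<close> the argument of \<open>nat\<close> is nonnegative, so
      nothing is truncated.\<close>
    have "int (triangle s + nat (int (Suc n) + s)) = int (Suc n + triangle (s + 1))"
      using that triangle_Suc[of s] by simp
    then have e: "triangle s + nat (int (Suc n) + s) = Suc n + triangle (s + 1)"
      by (simp only: of_nat_eq_iff)
    have "qbinom q (int (Suc n + k)) (int (Suc n) + s) =
        ?B s + q ^ nat (int (Suc n) + s) * ?B (s + 1)"
      using qbinom_pascal[OF q, of "int (n + k)" "int (Suc n) + s"] by (simp add: algebra_simps)
    then have "q ^ triangle s * qbinom q (int (Suc n + k)) (int (Suc n) + s) =
        q ^ triangle s * ?B s + q ^ (triangle s + nat (int (Suc n) + s)) * ?B (s + 1)"
      by (simp add: algebra_simps power_add)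
    then show ?thesis by (simp only: e) (simp add: power_add mult.assoc)
  qed
  have "theta_sum q k (Suc n) \<epsilon> = (\<Sum>s\<in>?A. \<epsilon> s *
      (q ^ triangle s * qbinom q (int (Suc n + k)) (int (Suc n) + s)))"
    by (rule theta_sum_superset) auto
  also have "\<dots> = (\<Sum>s\<in>?A. \<epsilon> s * (q ^ triangle s * ?B s)
      + q ^ Suc n * (\<epsilon> s * (q ^ triangle (s + 1) * ?B (s + 1))))"
    by (rule sum.cong[OF refl], subst summand) (simp_all add: algebra_simps)
  also have "\<dots> = (\<Sum>s\<in>?A. \<epsilon> s * (q ^ triangle s * ?B s))
      + q ^ Suc n * (\<Sum>s\<in>?A. \<epsilon> s * (q ^ triangle (s + 1) * ?B (s + 1)))"
    by (simp only: sum.distrib sum_distrib_left)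
  also have "(\<Sum>s\<in>?A. \<epsilon> s * (q ^ triangle s * ?B s)) = theta_sum q k n \<epsilon>"
    by (rule theta_sum_superset[symmetric]) auto
  also have "(\<Sum>s\<in>?A. \<epsilon> s * (q ^ triangle (s + 1) * ?B (s + 1))) =
      (\<Sum>s = - int n..int k + 1. \<epsilon> (s - 1) * (q ^ triangle s * ?B s))"
    by (rule sum.reindex_bij_witness[of _ "\<lambda>s. s - 1" "\<lambda>s. s + 1"]) auto
  also have "\<dots> = theta_sum q k n (\<lambda>s. \<epsilon> (s - 1))"
    by (rule theta_sum_superset[symmetric]) auto
  finally show ?thesis .
qed

text \<open>Dually, this adjoins 1 + z q^k: the mirrored recurrence carries the exponent k + 1 - s,
  and triangle s + (k + 1 - s) = k + triangle (s - 1).\<close>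

lemma theta_sum_Suc_upper:
  fixes q :: "'a::field"
  assumes q: "\<And>i::nat. i > 0 \<Longrightarrow> q ^ i \<noteq> 1"
  shows "theta_sum q (Suc k) n \<epsilon> =
    theta_sum q k n \<epsilon> + q ^ k * theta_sum q k n (\<lambda>s. \<epsilon> (s + 1))"
proof -
  let ?A = "{- int n..int k + 1}"
  let ?B = "\<lambda>s. qbinom q (int (n + k)) (int n + s)"
  have summand: "q ^ triangle s * qbinom q (int (n + Suc k)) (int n + s) =
      q ^ triangle s * ?B s + q ^ k * (q ^ triangle (s - 1) * ?B (s - 1))"
    if "s \<in> ?A" for s
  proof -
    have "int (triangle s + nat (int k + 1 - s)) = int (k + triangle (s - 1))"
      using that triangle_Suc[of "s - 1"] by simp
    then have e: "triangle s + nat (int k + 1 - s) = k + triangle (s - 1)"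
      by (simp only: of_nat_eq_iff)
    have "qbinom q (int (n + Suc k)) (int n + s) =
        ?B s + q ^ nat (int k + 1 - s) * ?B (s - 1)"
      using qbinom_pascal'[OF q, of "int (n + k)" "int n + s"] by (simp add: algebra_simps)
    then have "q ^ triangle s * qbinom q (int (n + Suc k)) (int n + s) =
        q ^ triangle s * ?B s + q ^ (triangle s + nat (int k + 1 - s)) * ?B (s - 1)"
      by (simp add: algebra_simps power_add)
    then show ?thesis by (simp only: e) (simp add: power_add mult.assoc)
  qed
  have "theta_sum q (Suc k) n \<epsilon> = (\<Sum>s\<in>?A. \<epsilon> s *
      (q ^ triangle s * qbinom q (int (n + Suc k)) (int n + s)))"
    by (rule theta_sum_superset) auto
  also have "\<dots> = (\<Sum>s\<in>?A. \<epsilon> s * (q ^ triangle s * ?B s)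
      + q ^ k * (\<epsilon> s * (q ^ triangle (s - 1) * ?B (s - 1))))"
    by (rule sum.cong[OF refl], subst summand) (simp_all add: algebra_simps)
  also have "\<dots> = (\<Sum>s\<in>?A. \<epsilon> s * (q ^ triangle s * ?B s))
      + q ^ k * (\<Sum>s\<in>?A. \<epsilon> s * (q ^ triangle (s - 1) * ?B (s - 1)))"
    by (simp only: sum.distrib sum_distrib_left)
  also have "(\<Sum>s\<in>?A. \<epsilon> s * (q ^ triangle s * ?B s)) = theta_sum q k n \<epsilon>"
    by (rule theta_sum_superset[symmetric]) auto
  also have "(\<Sum>s\<in>?A. \<epsilon> s * (q ^ triangle (s - 1) * ?B (s - 1))) =
      (\<Sum>s = - int n - 1..int k. \<epsilon> (s + 1) * (q ^ triangle s * ?B s))"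
    by (rule sum.reindex_bij_witness[of _ "\<lambda>s. s + 1" "\<lambda>s. s - 1"]) auto
  also have "\<dots> = theta_sum q k n (\<lambda>s. \<epsilon> (s + 1))"
    by (rule theta_sum_superset[symmetric]) auto
  finally show ?thesis .
qed

text \<open>From n to n + 1 both new factors carry the same power Q = q^(n+1). The hypothesis
  encodes 1 / z = - z, so (1 + z Q) (1 + Q / z) = 1 + Q^2. The base case leaves 1 + z.\<close>

lemma theta_sum_diagonal:
  fixes q :: "'a::field"
  assumes q: "\<And>i::nat. i > 0 \<Longrightarrow> q ^ i \<noteq> 1"
    and \<epsilon>: "\<And>s. \<epsilon> (s + 2) = - \<epsilon> s"
  shows "theta_sum q (Suc n) n \<epsilon> = qpoch (- (q ^ 2)) (q ^ 2) n * (\<epsilon> 0 + \<epsilon> 1)"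
proof (induction n)
  case 0
  have "{0..1::int} = {0, 1}" by auto
  moreover have "qbinom q 1 1 = 1"
    using qbinom_symmetric[of q 1 0] qbinom_0_right[OF q, of 1] by simp
  ultimately show ?case
    by (simp add: theta_sum_def qpoch_def triangle_def qbinom_0_right[OF q])
next
  case (Suc n)
  have "\<epsilon> (s + 1) = - \<epsilon> (s - 1)" for s using \<epsilon>[of "s - 1"] by (simp add: add.commute)
  \<comment> \<open>This cancels the two terms linear in q^(n+1) below.\<close>
  then have shift: "theta_sum q (Suc n) n (\<lambda>s. \<epsilon> (s + 1)) = - theta_sum q (Suc n) n (\<lambda>s. \<epsilon> (s - 1))"
    by (simp add: theta_sum_uminus)
  have "theta_sum q (Suc (Suc n)) (Suc n) \<epsilon> = (1 + q ^ Suc n * q ^ Suc n) * theta_sum q (Suc n) n \<epsilon>"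
    by (simp only: theta_sum_Suc_upper[OF q, of "Suc n"] theta_sum_Suc_lower[OF q] shift)
       (simp add: algebra_simps)
  moreover have "q ^ Suc n * q ^ Suc n = q ^ 2 * (q ^ 2) ^ n"
    by (simp add: power_mult_distrib power2_eq_square)
  ultimately show ?case
    by (simp only: Suc.IH qpoch_Suc) (simp add: algebra_simps)
qed

section \<open>Expansion of the remaining product over subsets\<close>

lemma sum_Pow_insert:
  assumes "finite I" "a \<notin> I"
  shows "(\<Sum>A\<in>Pow (insert a I). f A) = (\<Sum>A\<in>Pow I. f A) + (\<Sum>A\<in>Pow I. f (insert a A))"
proof -
  have "inj_on (insert a) (Pow I)" using assms(2) by (auto simp: inj_on_def)
  moreover have "Pow I \<inter> insert a ` Pow I = {}" using assms(2) by auto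
  ultimately show ?thesis
    using assms(1) by (simp add: Pow_insert sum.union_disjoint sum.reindex)
qed

text \<open>Multiplying out the factors 1 + z q^j with n < j <= n + t: A collects the j whose term z
  q^j is chosen, and z^(card A) becomes a shift.\<close>

lemma theta_sum_expand:
  fixes q :: "'a::field"
  assumes q: "\<And>i::nat. i > 0 \<Longrightarrow> q ^ i \<noteq> 1"
  shows "theta_sum q (Suc (n + t)) n \<epsilon> =
    (\<Sum>A\<in>Pow {n+1..n+t}. q ^ \<Sum>A * theta_sum q (Suc n) n (\<lambda>s. \<epsilon> (s + int (card A))))"
\<comment> \<open>The step also applies the induction hypothesis to the sequence shifted by
  one.\<close>
proof (induction t arbitrary: \<epsilon>)
  case 0
  then show ?case by simp
next
  case (Suc t)
  have fin: "finite A" "Suc (n + t) \<notin> A" if "A \<in> Pow {n+1..n+t}" for A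
    using that finite_subset[of A "{n+1..n+t}"] by auto
  have "{n+1..n+Suc t} = insert (Suc (n + t)) {n+1..n+t}" by auto
  then show ?case
    using fin
    by (simp add: sum_Pow_insert theta_sum_Suc_upper[OF q, of "Suc (n + t)"] Suc.IH
          sum_distrib_left power_add algebra_simps cong: sum.cong_simp)
qed

section \<open>Partitions into distinct parts as finite sets\<close>

text \<open>A multiset without repetitions is \<open>mset_set\<close> of its support, which turns
  partitions into subsets; \<open>0 \<notin> I\<close> makes the parts positive.\<close>

lemma p_d_conv_sets:
  assumes "finite I" "0 \<notin> I"
  shows "p_d N I M = card {A \<in> Pow I. int (card A) = M \<and> int (\<Sum>A) = N}"
proof -
  let ?S = "{A \<in> Pow I. int (card A) = M \<and> int (\<Sum>A) = N}"
  have fin: "finite A" if "A \<in> ?S" for A using that assms(1) by (auto intro: finite_subset)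
  have "distinct_partitions N I M = mset_set ` ?S"
  proof (intro equalityI subsetI)
    fix P assume P: "P \<in> distinct_partitions N I M"
    have "count P i = count (mset_set (set_mset P)) i" for i
      using P count_greater_zero_iff[of P i]
      by (cases "i \<in># P") (auto simp: distinct_partitions_def not_in_iff intro!: le_antisym)
    then have eq: "P = mset_set (set_mset P)" by (rule multiset_eqI)
    then have "size P = card (set_mset P)" "sum_mset P = \<Sum>(set_mset P)"
      by (metis size_mset_set, metis sum_unfold_sum_mset image_mset.identity id_apply)
    then have "set_mset P \<in> ?S"
      using P by (auto simp: distinct_partitions_def simp del: of_nat_sum of_nat_sum_mset)
    then show "P \<in> mset_set ` ?S" using eq by blast
  next
    fix P assume "P \<in> mset_set ` ?S"
    then obtain A where A: "A \<in> ?S" "P = mset_set A" by blast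
    have "sum_mset P = \<Sum>A" using A(2) by (simp add: sum_unfold_sum_mset)
    then show "P \<in> distinct_partitions N I M"
      using A fin[OF A(1)] assms(2)
      by (auto simp: distinct_partitions_def count_mset_set' simp del: of_nat_sum of_nat_sum_mset)
  qed
  moreover have "inj_on mset_set ?S"
    by (rule inj_on_inverseI[where g = set_mset], rule finite_set_mset_mset_set, rule fin)
  ultimately show ?thesis by (simp add: p_d_def card_image)
qed

text \<open>With c = card A, the extremes are the sums of n + 1, ..., n + c and of n + t - c + 1,
  ..., n + t. The bounds are doubled and rearranged to avoid halves and natural subtraction.\<close>

lemma sum_subset_bounds:
  assumes "A \<subseteq> {n+1..n+t}"
  shows "card A \<le> t \<and> 2 * card A * n + card A * (card A + 1) \<le> 2 * \<Sum>A \<and>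
    2 * \<Sum>A + card A * (card A + 1) \<le> 2 * card A * (n + t + 1)"
  using assms
proof (induction t arbitrary: A)
  case 0
  then show ?case by simp
next
  case (Suc t)
  show ?case
  proof (cases "Suc (n + t) \<in> A")
    case False
    then have "A \<subseteq> {n+1..n+t}" using Suc.prems by (force simp: le_Suc_eq)
    from Suc.IH[OF this] show ?thesis by (auto simp: algebra_simps)
  next
    case True
    define B where "B = A - {Suc (n + t)}"
    have B: "B \<subseteq> {n+1..n+t}" using Suc.prems by (force simp: le_Suc_eq B_def)
    have fin: "finite B" using B by (rule finite_subset) simp
    have "A = insert (Suc (n + t)) B" "Suc (n + t) \<notin> B" using True by (auto simp: B_def)
    then have "card A = Suc (card B)" "\<Sum>A = Suc (n + t) + \<Sum>B" using fin by auto
    \<comment> \<open>The lower bound relies on card B <= t: the new element n + t + 1 is at least n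
      + card B + 1.\<close>
    then show ?thesis using Suc.IH[OF B] by (auto simp: algebra_simps)
  qed
qed

text \<open>The interval from \<open>lo\<close> to \<open>hi\<close> contains every possible sum of
  M elements, so grouping the subsets by their sum loses none. For negative M both sides are
  0.\<close>

lemma sum_p_d_power:
  fixes q :: "'a::field" and lo hi M :: int
  assumes lo: "2 * lo \<le> M * (2 * int n + M + 1)" and hi: "M * (2 * int n + 2 * int t + 1 - M) \<le> 2 * hi"
  shows "(\<Sum>j = lo..hi. of_nat (p_d j {n+1..n+t} M) * q powi j) =
    (\<Sum>A | A \<in> Pow {n+1..n+t} \<and> int (card A) = M. q ^ \<Sum>A)"
proof -
  let ?S = "{A. A \<in> Pow {n+1..n+t} \<and> int (card A) = M}"
  have fin: "finite ?S" by (rule finite_subset[of _ "Pow {n+1..n+t}"]) auto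
  have sub: "(\<lambda>A. int (\<Sum>A)) ` ?S \<subseteq> {lo..hi}"
  proof
    fix j assume "j \<in> (\<lambda>A. int (\<Sum>A)) ` ?S"
    then obtain A where A: "A \<subseteq> {n+1..n+t}" "int (card A) = M" "j = int (\<Sum>A)" by auto
    from sum_subset_bounds[OF A(1)]
    have "int (2 * card A * n + card A * (card A + 1)) \<le> int (2 * \<Sum>A)"
      "int (2 * \<Sum>A + card A * (card A + 1)) \<le> int (2 * card A * (n + t + 1))"
      by (simp_all only: of_nat_le_iff)
    then have "M * (2 * int n + M + 1) \<le> 2 * j" "2 * j \<le> M * (2 * int n + 2 * int t + 1 - M)"
      unfolding of_nat_add of_nat_mult A(2) A(3)[symmetric] by (simp_all add: algebra_simps)
    then show "j \<in> {lo..hi}" using lo hi by simp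
  qed
  have "of_nat (p_d j {n+1..n+t} M) * q powi j = (\<Sum>A | A \<in> ?S \<and> int (\<Sum>A) = j. q ^ \<Sum>A)" for j
  proof -
    have "(\<Sum>A | A \<in> ?S \<and> int (\<Sum>A) = j. q ^ \<Sum>A) = (\<Sum>A | A \<in> ?S \<and> int (\<Sum>A) = j. q powi j)"
      by (rule sum.cong) (auto simp del: of_nat_sum)
    then show ?thesis by (simp add: p_d_conv_sets conj_assoc)
  qed
  then show ?thesis using sum.group[OF fin _ sub, of "\<lambda>A. q ^ \<Sum>A"] by simp
qed

text \<open>Covers all four double sums, with c = 0, 2, -1, 1. For M = 4 l + c parts,
  \<open>lo l\<close> and \<open>hi l\<close> are the extreme sums just found, and \<open>u\<close>
  is the largest l with M <= m - 1; it is -1 if m - 1 < c. Subsets are grouped first by l, then by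
  sum.\<close>

lemma sum_card_residue_class:
  fixes q :: "'a::field" and c :: int and N :: "int \<Rightarrow> int \<Rightarrow> nat"
  assumes m: "m > 0" and c: "-1 \<le> c" "c \<le> 2"
    and N: "\<And>j l. N j l = p_d j {n+1..n+m-1} (4 * l + c)"
    and lo: "\<And>l. 2 * lo l = (4 * l + c) * (2 * int n + (4 * l + c) + 1)"
    and hi: "\<And>l. 2 * hi l = (4 * l + c) * (2 * int n + 2 * int m - 1 - (4 * l + c))"
    and u: "u = (int m - 1 - c) div 4"
  shows "(\<Sum>l = 0..u. \<Sum>j = lo l..hi l. of_nat (N j l) * q powi j) =
    (\<Sum>A\<in>Pow {n+1..n+m-1}. if int (card A) mod 4 = c mod 4 then q ^ \<Sum>A else 0)"
proof -
  define t where "t = m - 1"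
  have t: "n + m - 1 = n + t" "int m = int t + 1" using m by (auto simp: t_def)
  let ?S = "{A \<in> Pow {n+1..n+t}. int (card A) mod 4 = c mod 4}"
  let ?g = "\<lambda>A::nat set. (int (card A) - c) div 4"
  have fin: "finite ?S" by simp
  have sub: "?g ` ?S \<subseteq> {0..u}"
  proof
    fix l assume "l \<in> ?g ` ?S"
    then obtain A where A: "A \<subseteq> {n+1..n+t}" "int (card A) mod 4 = c mod 4" "l = ?g A" by auto
    have "int (card A) \<le> int t" using sum_subset_bounds[OF A(1)] by simp
    then have "l \<le> u" unfolding u A(3) t(2) by (intro zdiv_mono1) auto
    \<comment> \<open>The difference card A - c is divisible by 4 and at least -2.\<close>
    moreover have "0 \<le> l" using A(2,3) c by presburger
    ultimately show "l \<in> {0..u}" by simp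
  qed
  have "(\<Sum>j = lo l..hi l. of_nat (N j l) * q powi j) = (\<Sum>A | A \<in> ?S \<and> ?g A = l. q ^ \<Sum>A)" for l
  proof -
    have "(\<Sum>j = lo l..hi l. of_nat (N j l) * q powi j) =
        (\<Sum>A | A \<in> Pow {n+1..n+t} \<and> int (card A) = 4 * l + c. q ^ \<Sum>A)"
      unfolding N t(1) using lo[of l] hi[of l] t(2)
      by (intro sum_p_d_power) (simp_all add: algebra_simps)
    moreover have "int (card A) = 4 * l + c \<longleftrightarrow> int (card A) mod 4 = c mod 4 \<and> ?g A = l" for A :: "nat set"
      by (auto simp: mod_eq_dvd_iff)
    ultimately show ?thesis by (simp add: conj_assoc)
  qed
  then have "(\<Sum>l = 0..u. \<Sum>j = lo l..hi l. of_nat (N j l) * q powi j) = (\<Sum>A\<in>?S. q ^ \<Sum>A)"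
    using sum.group[OF fin _ sub, of "\<lambda>A. q ^ \<Sum>A"] by simp
  then show ?thesis unfolding t(1) by (simp only: sum.inter_filter finite_Pow_iff finite_atLeastAtMost)
qed

section \<open>Extracting the even indices\<close>

text \<open>The real part of \<open>\<i> ^ s\<close>.\<close>

definition re_ipow :: "int \<Rightarrow> 'a::field" where
  "re_ipow s = (if even s then (- 1) powi (s div 2) else 0)"

lemma re_ipow_add_2: "re_ipow (s + 2) = - re_ipow s"
  by (simp add: re_ipow_def power_int_add)

lemma re_ipow_mod_4:
  "re_ipow s = (if s mod 4 = 0 then 1 else if s mod 4 = 2 then - 1 else 0)"
proof -
  have "even s \<Longrightarrow> s mod 4 = (if even (s div 2) then 0 else 2)"
    "odd s \<Longrightarrow> s mod 4 \<noteq> 0 \<and> s mod 4 \<noteq> 2"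
    by presburger+
  then show ?thesis by (simp add: re_ipow_def power_int_minus_left)
qed

text \<open>Substitute s = 2 k: triangle (2 k) = 2 k^2 - k, and \<open>re_ipow\<close> kills the odd
  s.\<close>

lemma Sum_any_eq_theta_sum:
  fixes q :: "'a::field"
  shows "Sum_any (\<lambda>k::int. (- 1) powi k * q powi (2 * k ^ 2 - k)
             * qbinom q (int (2 * n + m)) (int n + 2 * k)) = theta_sum q (n + m) n re_ipow"
proof -
  let ?f = "\<lambda>k::int. (- 1) powi k * q powi (2 * k ^ 2 - k)
             * qbinom q (int (2 * n + m)) (int n + 2 * k)"
  let ?I = "{- int n..int (n + m)}"
  let ?K = "{k. 2 * k \<in> ?I}"
  let ?g = "\<lambda>s. re_ipow s * (q ^ triangle s * qbinom q (int (n + (n + m))) (int n + s))"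
  have fin: "finite ?K" by (rule finite_subset[of _ ?I]) auto
  have sup: "{k. ?f k \<noteq> 0} \<subseteq> ?K" by (auto simp: qbinom_def split: if_splits)
  have fg: "?f k = ?g (2 * k)" for k
  proof -
    have "int (triangle (2 * k)) = 2 * k ^ 2 - k"
      using int_triangle[of "2 * k"] by (simp add: algebra_simps power2_eq_square)
    then have "q powi (2 * k ^ 2 - k) = q ^ triangle (2 * k)"
      by (metis power_int_of_nat)
    then show ?thesis by (simp add: re_ipow_def algebra_simps)
  qed
  have "Sum_any ?f = (\<Sum>k\<in>?K. ?g (2 * k))"
    unfolding Sum_any.expand_superset[OF fin sup] by (simp only: fg)
  also have "\<dots> = (\<Sum>s\<in>(\<lambda>k. 2 * k) ` ?K. ?g s)"
    by (subst sum.reindex) (auto simp: inj_on_def)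
  also have "\<dots> = (\<Sum>s\<in>?I. ?g s)"
    by (rule sum.mono_neutral_left) (auto simp: re_ipow_def elim!: evenE)
  finally show ?thesis by (simp add: theta_sum_def)
qed

section \<open>Comparison of both sides as sums over subsets of {n+1..n+m-1}\<close>

theorem theorem3:
  fixes q :: "'a::field" and n m :: nat
  assumes q: "\<And>i::nat. i > 0 \<Longrightarrow> q ^ i \<noteq> 1"
    and n: "n > 0" and m: "m > 0"
  shows "Sum_any (\<lambda>k::int. (- 1) powi k * q powi (2 * k ^ 2 - k)
             * qbinom q (int (2 * n + m)) (int n + 2 * k))
    = qpoch (- (q ^ 2)) (q ^ 2) n *
      ((\<Sum>l = (0::int)..(int m - 1) div 4.
          \<Sum>j = 2 * l * (2 * int n + 4 * l + 1)..2 * l * (2 * int n + 2 * int m - 4 * l - 1).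
            of_nat (a_coeff n m j l) * q powi j)
       + (\<Sum>l = (0::int)..int m div 4.
          \<Sum>j = (4 * l - 1) * (int n + 2 * l)..(4 * l - 1) * (int n + int m - 2 * l).
            of_nat (c_coeff n m j l) * q powi j)
       - ((\<Sum>l = (0::int)..(int m - 3) div 4.
          \<Sum>j = (2 * l + 1) * (2 * int n + 4 * l + 3)..(2 * l + 1) * (2 * int n + 2 * int m - 4 * l - 3).
            of_nat (b_coeff n m j l) * q powi j)
       + (\<Sum>l = (0::int)..(int m - 2) div 4.
          \<Sum>j = (4 * l + 1) * (int n + 2 * l + 1)..(4 * l + 1) * (int n + int m - 2 * l - 1).
            of_nat (d_coeff n m j l) * q powi j)))"
proof -
  let ?I = "Pow {n+1..n+m-1}"
  let ?R = "\<lambda>c::int. \<Sum>A\<in>?I. if int (card A) mod 4 = c mod 4 then q ^ \<Sum>A else 0"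
  have a: "(\<Sum>l = (0::int)..(int m - 1) div 4.
          \<Sum>j = 2 * l * (2 * int n + 4 * l + 1)..2 * l * (2 * int n + 2 * int m - 4 * l - 1).
            of_nat (a_coeff n m j l) * q powi j) = ?R 0"
    by (rule sum_card_residue_class[OF m]) (simp_all add: a_coeff_def algebra_simps)
  have b: "(\<Sum>l = (0::int)..(int m - 3) div 4.
          \<Sum>j = (2 * l + 1) * (2 * int n + 4 * l + 3)..(2 * l + 1) * (2 * int n + 2 * int m - 4 * l - 3).
            of_nat (b_coeff n m j l) * q powi j) = ?R 2"
    by (rule sum_card_residue_class[OF m]) (simp_all add: b_coeff_def algebra_simps)
  \<comment> \<open>Here l = 0 asks for -1 parts and contributes nothing; the residue -1 is 3 modulo
    4.\<close>
  have c: "(\<Sum>l = (0::int)..int m div 4.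
          \<Sum>j = (4 * l - 1) * (int n + 2 * l)..(4 * l - 1) * (int n + int m - 2 * l).
            of_nat (c_coeff n m j l) * q powi j) = ?R (- 1)"
    by (rule sum_card_residue_class[OF m]) (simp_all add: c_coeff_def algebra_simps)
  have d: "(\<Sum>l = (0::int)..(int m - 2) div 4.
          \<Sum>j = (4 * l + 1) * (int n + 2 * l + 1)..(4 * l + 1) * (int n + int m - 2 * l - 1).
            of_nat (d_coeff n m j l) * q powi j) = ?R 1"
    by (rule sum_card_residue_class[OF m]) (simp_all add: d_coeff_def algebra_simps)
  \<comment> \<open>The real part of (1 + \<i>) \<i>^x is 1, -1, -1, 1 for x = 0, 1, 2, 3 modulo 4.
    Residues 0 and 3 belong to the a- and c-sums, 2 and 1 to the b- and d-sums.\<close>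
  have sgn: "q ^ \<Sum>A * (re_ipow (int (card A)) + re_ipow (1 + int (card A))) =
      (if int (card A) mod 4 = 0 mod 4 then q ^ \<Sum>A else 0)
      + (if int (card A) mod 4 = - 1 mod 4 then q ^ \<Sum>A else 0)
      - ((if int (card A) mod 4 = 2 mod 4 then q ^ \<Sum>A else 0)
         + (if int (card A) mod 4 = 1 mod 4 then q ^ \<Sum>A else 0))" for A :: "nat set"
  proof -
    define x where "x = int (card A)"
    have "x mod 4 = 0 \<and> (1 + x) mod 4 = 1 \<or> x mod 4 = 1 \<and> (1 + x) mod 4 = 2
      \<or> x mod 4 = 2 \<and> (1 + x) mod 4 = 3 \<or> x mod 4 = 3 \<and> (1 + x) mod 4 = 0"
      by presburger
    then show ?thesis unfolding x_def[symmetric] by (auto simp: re_ipow_mod_4)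
  qed
  have diag: "theta_sum q (Suc n) n (\<lambda>s. re_ipow (s + int (card A))) =
      qpoch (- (q ^ 2)) (q ^ 2) n * (re_ipow (int (card A)) + re_ipow (1 + int (card A)))"
    for A :: "nat set"
  proof -
    have "(re_ipow (s + 2 + int (card A)) :: 'a) = - re_ipow (s + int (card A))" for s
      using re_ipow_add_2[of "s + int (card A)"] by (simp add: ac_simps)
    then show ?thesis
      using theta_sum_diagonal[OF q, where \<epsilon> = "\<lambda>s. re_ipow (s + int (card A))"] by simp
  qed
  \<comment> \<open>Of the n + m factors 1 + z q^j, the diagonal case takes those with j <= n; since
    m > 0, exactly m - 1 remain.\<close>
  have nm: "n + m = Suc (n + (m - 1))" "n + m - 1 = n + (m - 1)" using m by auto
  have "theta_sum q (n + m) n re_ipow = (\<Sum>A\<in>?I. q ^ \<Sum>A *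
      theta_sum q (Suc n) n (\<lambda>s. re_ipow (s + int (card A))))"
    unfolding nm(2) by (subst nm(1)) (rule theta_sum_expand[OF q])
  also have "\<dots> = (\<Sum>A\<in>?I. q ^ \<Sum>A *
      (qpoch (- (q ^ 2)) (q ^ 2) n * (re_ipow (int (card A)) + re_ipow (1 + int (card A)))))"
    by (simp only: diag)
  also have "\<dots> = qpoch (- (q ^ 2)) (q ^ 2) n *
      (\<Sum>A\<in>?I. q ^ \<Sum>A * (re_ipow (int (card A)) + re_ipow (1 + int (card A))))"
    by (simp add: sum_distrib_left mult.left_commute)
  also have "\<dots> = qpoch (- (q ^ 2)) (q ^ 2) n * (?R 0 + ?R (- 1) - (?R 2 + ?R 1))"
    by (simp only: sgn sum.distrib sum_subtractf)
  finally show ?thesis unfolding a b c d Sum_any_eq_theta_sum .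
qed

end
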